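(* Let $k\in\mathbb{N}$, $k\ge 1$, and let a $k$-step linear multistep method be given by real coefficients $\alpha_0,\dots,\alpha_k$, $\beta_0,\dots,\beta_k$ with $\alpha_0\neq 0$. If the method is weakly stable, then it is not stable in the norm pair $\left(\|\cdot\|_{k\infty},\|\cdot\|_{k\$}\right)$.
   Context: **Initial value problem (IVP).** An IVP is the scalar autonomous problem $u(0)=u^0$, $\dot u(t)=f(u(t))$ for $t\in[0,T]$, where $T>0$, $u^0\in\mathbb{R}$, and $f:\mathbb{R}\to\mathbb{R}$ is Lipschitz continuous. **Linear multistep method.** Fix $k\ge 1$ and real coefficients $\alpha_0,\dots,\alpha_k,\beta_0,\dots,\beta_k$ with $\alpha_0\ne 0$. For $n\ge 1$ put $N=n+k-1$ and $h=T/N$ ($k$ is fixed, while $n$, $N$, $h$ vary). Given starting values $c^0,\dots,c^{k-1}\in\mathbb{R}$, which are some approximations of the solution on the first $k$ time levels, the method applied to the IVP is the system $F_N(\mathbf{u}_N)=\mathbf{0}$ for $\mathbf{u}_N=(u_0,\dots,u_N)^T\in\mathbb{R}^{k+n}$, where $F_N:\mathbb{R}^{k+n}\to\mathbb{R}^{k+n}$ is $$(F_N(\mathbf{u}_N))_i=\begin{cases}u_i-c^i, & i=0,\dots,k-1,\\ \dfrac1h\sum_{j=0}^{k}\alpha_j u_{i-j}-\sum_{j=0}^{k}\beta_j f(u_{i-j}), & i=k,\dots,n+k-1=N.\end{cases}$$ (The starting values $c^i$ cancel in differences $F_N(\mathbf{u}_N)-F_N(\mathbf{v}_N)$.) **Strong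 and weak stability.** The first characteristic polynomial of the method is $\varrho(z)=\sum_{j=0}^k\alpha_j z^{k-j}$. - The method is *strongly stable* if $1$ is a simple root of $\varrho$ and every other root $\xi\in\mathbb{C}$ of $\varrho$ satisfies $|\xi|<1$. - The method is *weakly stable* if it is not strongly stable, every root $\xi\in\mathbb{C}$ of $\varrho$ satisfies $|\xi|\le 1$, every root with $|\xi|=1$ is simple, and $1$ is a root of $\varrho$. **Norms.** For $\mathbf{u}_N=(u_0,\dots,u_N)^T\in\mathbb{R}^{k+n}$, with $N=n+k-1$ and $h=T/N$, define $$\|\mathbf{u}_N\|_{k\infty}=\max_{0\le i\le k-1}|u_i|+\max_{k\le i\le N}|u_i|,\qquad \|\mathbf{u}_N\|_{k\$}=\max_{0\le i\le k-1}|u_i|+h\max_{k\le l\le N}\left|\sum_{i=k}^{l}u_i\right|.$$ **Stability in a norm pair.** Let $\|\cdot\|_{\mathcal{X}_N}$ and $\|\cdot\|_{\mathcal{Y}_N}$ be norms on $\mathbb{R}^{k+n}$ for each $N=n+k-1$. The method is *stable in the norm pair* $(\|\cdot\|_{\mathcal{X}_N},\|\cdot\|_{\mathcal{Y}_N})$ if for every IVP there exist $S\in\mathbb{R}$ and $N_0\in\mathbb{N}$ such that for all $N\ge N_0$ and all $\mathbf{u}_N,\mathbf{v}_N\in\mathbb{R}^{k+n}$ $$\|\mathbf{u}_N-\mathbf{v}_N\|_{\mathcal{X}_N}\le S\,\|F_N(\mathbf{u}_N)-F_N(\mathbf{v}_N)\|_{\mathcal{Y}_N}.$$ Stability in the norm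 pair $(\|\cdot\|_{k\infty},\|\cdot\|_{k\$})$ means this with $\|\cdot\|_{\mathcal{X}_N}=\|\cdot\|_{k\infty}$ and $\|\cdot\|_{\mathcal{Y}_N}=\|\cdot\|_{k\$}$. *)

theory Defs
  imports Complex_Main "HOL-Analysis.Lipschitz" "HOL-Computational_Algebra.Polynomial"
begin

text \<open>
  A vector (u_0, ..., u_N) is represented by a function \<open>u :: nat \<Rightarrow> real\<close>; only its values at
  indices up to N matter, since nothing below reads an entry beyond N. A k-step method is given
  by \<open>k\<close> and coefficient sequences \<open>\<alpha>, \<beta> :: nat \<Rightarrow> real\<close>, of which only the entries 0, ..., k are
  read. With n denoting the number of non-starting time levels, N = n + k - 1 and n \<ge> 1 amount
  to N \<ge> k.
\<close>

definition is_ivp :: "real \<Rightarrow> real \<Rightarrow> (real \<Rightarrow> real) \<Rightarrow> bool" where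
  "is_ivp T u0 f \<longleftrightarrow> T > 0 \<and> (\<exists>L. L-lipschitz_on UNIV f)"
  \<comment> \<open>The initial value \<open>u0\<close> is an arbitrary real.\<close>

definition step_size :: "real \<Rightarrow> nat \<Rightarrow> real" where
  "step_size T N = T / real N"

definition lmm_map ::
  "nat \<Rightarrow> (nat \<Rightarrow> real) \<Rightarrow> (nat \<Rightarrow> real) \<Rightarrow> real \<Rightarrow> (real \<Rightarrow> real) \<Rightarrow> (nat \<Rightarrow> real) \<Rightarrow> nat
    \<Rightarrow> (nat \<Rightarrow> real) \<Rightarrow> (nat \<Rightarrow> real)" where
  "lmm_map k \<alpha> \<beta> T f c N u = (\<lambda>i.
     if i < k then u i - c i
     else (1 / step_size T N) * (\<Sum>j=0..k. \<alpha> j * u (i - j)) - (\<Sum>j=0..k. \<beta> j * f (u (i - j))))"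

definition char_poly1 :: "nat \<Rightarrow> (nat \<Rightarrow> real) \<Rightarrow> complex poly" where
  "char_poly1 k \<alpha> = (\<Sum>j=0..k. monom (complex_of_real (\<alpha> j)) (k - j))"

definition strongly_stable :: "nat \<Rightarrow> (nat \<Rightarrow> real) \<Rightarrow> bool" where
  "strongly_stable k \<alpha> \<longleftrightarrow>
     order 1 (char_poly1 k \<alpha>) = 1 \<and>
     (\<forall>\<xi>. poly (char_poly1 k \<alpha>) \<xi> = 0 \<and> \<xi> \<noteq> 1 \<longrightarrow> cmod \<xi> < 1)"

definition weakly_stable :: "nat \<Rightarrow> (nat \<Rightarrow> real) \<Rightarrow> bool" where
  "weakly_stable k \<alpha> \<longleftrightarrow>
     \<not> strongly_stable k \<alpha> \<and>
     (\<forall>\<xi>. poly (char_poly1 k \<alpha>) \<xi> = 0 \<longrightarrow> cmod \<xi> \<le> 1) \<and>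
     (\<forall>\<xi>. poly (char_poly1 k \<alpha>) \<xi> = 0 \<and> cmod \<xi> = 1 \<longrightarrow> order \<xi> (char_poly1 k \<alpha>) = 1) \<and>
     poly (char_poly1 k \<alpha>) 1 = 0"

text \<open>
  Norm families take the final time T and the index N, because a norm may involve the step size
  h = T / N.
\<close>

definition norm_kinf :: "nat \<Rightarrow> real \<Rightarrow> nat \<Rightarrow> (nat \<Rightarrow> real) \<Rightarrow> real" where
  "norm_kinf k T N u = (MAX i\<in>{0..<k}. \<bar>u i\<bar>) + (MAX i\<in>{k..N}. \<bar>u i\<bar>)"

definition norm_kdollar :: "nat \<Rightarrow> real \<Rightarrow> nat \<Rightarrow> (nat \<Rightarrow> real) \<Rightarrow> real" where
  "norm_kdollar k T N u =
     (MAX i\<in>{0..<k}. \<bar>u i\<bar>) + step_size T N * (MAX l\<in>{k..N}. \<bar>\<Sum>i=k..l. u i\<bar>)"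

definition stable_in_norm_pair ::
  "nat \<Rightarrow> (nat \<Rightarrow> real) \<Rightarrow> (nat \<Rightarrow> real)
    \<Rightarrow> (real \<Rightarrow> nat \<Rightarrow> (nat \<Rightarrow> real) \<Rightarrow> real) \<Rightarrow> (real \<Rightarrow> nat \<Rightarrow> (nat \<Rightarrow> real) \<Rightarrow> real) \<Rightarrow> bool" where
  "stable_in_norm_pair k \<alpha> \<beta> normX normY \<longleftrightarrow>
     (\<forall>T u0 f. is_ivp T u0 f \<longrightarrow>
       (\<exists>(S::real) (N0::nat). \<forall>N\<ge>N0. N \<ge> k \<longrightarrow>
         (\<forall>c u v. normX T N (\<lambda>i. u i - v i)
            \<le> S * normY T N (\<lambda>i. lmm_map k \<alpha> \<beta> T f c N u i - lmm_map k \<alpha> \<beta> T f c N v i))))"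

text \<open>
  The starting values cancel in the difference, so how \<open>c\<close> is quantified in the definition above
  is immaterial.
\<close>

lemma lmm_map_diff_starting_values:
  "lmm_map k \<alpha> \<beta> T f c N u i - lmm_map k \<alpha> \<beta> T f c N v i =
   lmm_map k \<alpha> \<beta> T f c' N u i - lmm_map k \<alpha> \<beta> T f c' N v i"
  by (simp add: lmm_map_def)

end

theory Submission
  imports Defs
begin

text \<open>
  A weakly stable method has a root \<open>\<xi> \<noteq> 1\<close> of the first characteristic polynomial on the unit
  circle. Already for the right-hand side 0, the resonant sequence \<open>n \<xi>^n\<close> violates stability:
  the difference operator of the method maps it to a multiple of \<open>\<xi>^n\<close>, whose partial sums stay
  bounded because \<open>\<xi> \<noteq> 1\<close>, while its \<open>N\<close>-th entry has modulus \<open>N\<close>. Rotating by \<open>cnj (\<xi>^N)\<close>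
  before taking real parts makes that last entry equal to \<open>N\<close>.
\<close>

lemma poly_char_poly1:
  "poly (char_poly1 k \<alpha>) z = (\<Sum>j=0..k. of_real (\<alpha> j) * z ^ (k - j))"
  by (simp add: char_poly1_def poly_sum poly_monom)

text \<open>Weak stability makes 1 a simple root, so strong stability can only fail through another
  root of modulus at least 1, and the root condition caps that modulus at 1.\<close>

lemma weakly_stable_unimodular_root:
  assumes "weakly_stable k \<alpha>"
  obtains \<xi> where "poly (char_poly1 k \<alpha>) \<xi> = 0" "cmod \<xi> = 1" "\<xi> \<noteq> 1"
  using assms unfolding weakly_stable_def strongly_stable_def
  by (metis norm_one order_le_less)

text \<open>Split the factor \<open>i - j\<close>: the part with \<open>i\<close> is a multiple of
  the characteristic polynomial at \<open>\<xi>\<close> and vanishes. What remains is a constant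
  times \<open>\<xi> ^ (i - k)\<close>; by the root property the constant, sign included, is
  \<open>\<xi>\<close> times the derivative of the polynomial at \<open>\<xi>\<close>.\<close>

lemma difference_operator_resonance:
  fixes \<xi> :: complex
  assumes "poly (char_poly1 k \<alpha>) \<xi> = 0" and "k \<le> i"
  shows "(\<Sum>j=0..k. of_real (\<alpha> j) * (of_nat (i - j) * \<xi> ^ (i - j))) =
    - (\<Sum>j=0..k. of_nat j * of_real (\<alpha> j) * \<xi> ^ (k - j)) * \<xi> ^ (i - k)"
proof -
  have "of_real (\<alpha> j) * (of_nat (i - j) * \<xi> ^ (i - j)) =
      of_nat i * \<xi> ^ (i - k) * (of_real (\<alpha> j) * \<xi> ^ (k - j))
      - \<xi> ^ (i - k) * (of_nat j * of_real (\<alpha> j) * \<xi> ^ (k - j))" if "j \<in> {0..k}" for j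
  proof -
    have "\<xi> ^ (i - j) = \<xi> ^ (i - k) * \<xi> ^ (k - j)"
      using that assms(2) by (simp flip: power_add)
    then show ?thesis
      using that assms(2) by (simp add: of_nat_diff algebra_simps)
  qed
  then have "(\<Sum>j=0..k. of_real (\<alpha> j) * (of_nat (i - j) * \<xi> ^ (i - j))) =
      of_nat i * \<xi> ^ (i - k) * poly (char_poly1 k \<alpha>) \<xi>
      - \<xi> ^ (i - k) * (\<Sum>j=0..k. of_nat j * of_real (\<alpha> j) * \<xi> ^ (k - j))"
    by (simp add: poly_char_poly1 sum_subtractf sum_distrib_left)
  then show ?thesis
    using assms(1) by simp
qed

text \<open>The geometric sum has a numerator of modulus at most 2 whatever its length, so the bound
  does not depend on \<open>l\<close>.\<close>

lemma norm_sum_power_unimodular_le: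
  fixes \<xi> :: complex
  assumes "cmod \<xi> = 1" and "\<xi> \<noteq> 1" and "k \<le> l"
  shows "cmod (\<Sum>i=k..l. \<xi> ^ (i - k)) \<le> 2 / cmod (1 - \<xi>)"
proof -
  have "(\<Sum>i=k..l. \<xi> ^ (i - k)) = (\<Sum>i<Suc (l - k). \<xi> ^ i)"
    using assms(3)
    by (intro sum.reindex_bij_witness[of _ "\<lambda>i. i + k" "\<lambda>i. i - k"]) auto
  also have "\<dots> = (1 - \<xi> ^ Suc (l - k)) / (1 - \<xi>)"
    using assms(2) by (simp only: sum_gp_strict if_False)
  finally have "cmod (\<Sum>i=k..l. \<xi> ^ (i - k)) = cmod (1 - \<xi> ^ Suc (l - k)) / cmod (1 - \<xi>)"
    by (simp only: norm_divide)
  moreover have "cmod (1 - \<xi> ^ Suc (l - k)) \<le> 2"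
    using norm_triangle_ineq4[of 1 "\<xi> ^ Suc (l - k)"] assms(1)
    by (simp add: norm_power norm_mult)
  ultimately show ?thesis
    by (simp add: divide_right_mono)
qed

lemma Max_abs_nonneg:
  fixes f :: "'a \<Rightarrow> real"
  assumes "finite I" and "I \<noteq> {}"
  shows "0 \<le> (MAX i\<in>I. \<bar>f i\<bar>)"
  using assms by (auto simp: Max_ge_iff)

lemma norm_kinf_ge:
  assumes "k \<ge> 1" and "k \<le> N"
  shows "\<bar>u N\<bar> \<le> norm_kinf k T N u"
proof -
  have "0 \<le> (MAX i\<in>{0..<k}. \<bar>u i\<bar>)"
    using assms(1) by (intro Max_abs_nonneg) auto
  moreover have "\<bar>u N\<bar> \<le> (MAX i\<in>{k..N}. \<bar>u i\<bar>)"
    using assms(2) by (intro Max_ge) auto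
  ultimately show ?thesis
    by (simp add: norm_kinf_def)
qed

lemma norm_kdollar_nonneg:
  assumes "k \<ge> 1" and "k \<le> N" and "T \<ge> 0"
  shows "0 \<le> norm_kdollar k T N u"
  unfolding norm_kdollar_def step_size_def using assms
  by (intro add_nonneg_nonneg mult_nonneg_nonneg Max_abs_nonneg) auto

lemma norm_kdollar_le:
  assumes "k \<ge> 1" and "k \<le> N"
    and start: "\<And>i. i < k \<Longrightarrow> \<bar>u i\<bar> \<le> A"
    and sums: "\<And>l. k \<le> l \<Longrightarrow> l \<le> N \<Longrightarrow> step_size T N * \<bar>\<Sum>i=k..l. u i\<bar> \<le> B"
  shows "norm_kdollar k T N u \<le> A + B"
proof -
  have "(MAX i\<in>{0..<k}. \<bar>u i\<bar>) \<le> A"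
    using assms(1) start by (subst Max_le_iff) auto
  \<comment> \<open>The maximum is itself one of the partial sums, so \<open>sums\<close>, which
    already carries the step size, applies to it.\<close>
  moreover have "(MAX l\<in>{k..N}. \<bar>\<Sum>i=k..l. u i\<bar>) \<in> (\<lambda>l. \<bar>\<Sum>i=k..l. u i\<bar>) ` {k..N}"
    using assms(2) by (intro Max_in) auto
  then have "step_size T N * (MAX l\<in>{k..N}. \<bar>\<Sum>i=k..l. u i\<bar>) \<le> B"
    using sums by auto
  ultimately show ?thesis
    by (simp add: norm_kdollar_def)
qed

theorem theorem3p2:
  fixes k :: nat and \<alpha> \<beta> :: "nat \<Rightarrow> real"
  assumes "k \<ge> 1"
    and "\<alpha> 0 \<noteq> 0"
    and "weakly_stable k \<alpha>"
  shows "\<not> stable_in_norm_pair k \<alpha> \<beta> (norm_kinf k) (norm_kdollar k)"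
proof
  assume stable: "stable_in_norm_pair k \<alpha> \<beta> (norm_kinf k) (norm_kdollar k)"
  obtain \<xi> where root: "poly (char_poly1 k \<alpha>) \<xi> = 0" and unit: "cmod \<xi> = 1" and "\<xi> \<noteq> 1"
    using weakly_stable_unimodular_root[OF assms(3)] .
  define D where "D = (\<Sum>j=0..k. of_nat j * of_real (\<alpha> j) * \<xi> ^ (k - j))"
  define B where "B = cmod D * (2 / cmod (1 - \<xi>))"
  \<comment> \<open>One problem suffices for a contradiction. With right-hand side 0 the
    \<open>\<beta>\<close> terms vanish, and final time 1 gives step size
    \<open>1 / N\<close>.\<close>
  have "is_ivp 1 0 (\<lambda>_. 0)"
    by (auto simp: is_ivp_def lipschitz_on_def)
  then obtain S :: real and N0 :: nat where S: "\<And>N c u v. N \<ge> N0 \<Longrightarrow> N \<ge> k \<Longrightarrow>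
      norm_kinf k 1 N (\<lambda>i. u i - v i) \<le> S * norm_kdollar k 1 N
        (\<lambda>i. lmm_map k \<alpha> \<beta> 1 (\<lambda>_. 0) c N u i - lmm_map k \<alpha> \<beta> 1 (\<lambda>_. 0) c N v i)"
    using stable unfolding stable_in_norm_pair_def by metis
  \<comment> \<open>The right-hand side does not depend on \<open>N\<close>, so this cannot hold for
    all large \<open>N\<close>.\<close>
  have bound: "real N \<le> \<bar>S\<bar> * (real k + B)" if N: "N \<ge> N0" "N \<ge> k" for N
  proof -
    define u where "u n = Re (cnj (\<xi> ^ N) * (of_nat n * \<xi> ^ n))" for n
    define r where "r i = lmm_map k \<alpha> \<beta> 1 (\<lambda>_. 0) (\<lambda>_. 0) N u i
      - lmm_map k \<alpha> \<beta> 1 (\<lambda>_. 0) (\<lambda>_. 0) N (\<lambda>_. 0) i" for i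
    have "N > 0"
      using assms(1) N by simp
    have uN: "u N = real N"
    proof -
      have "cnj (\<xi> ^ N) * \<xi> ^ N = 1"
        using unit complex_norm_square[of "\<xi> ^ N"] by (simp add: norm_power mult.commute)
      then have "cnj (\<xi> ^ N) * (of_nat N * \<xi> ^ N) = of_nat N"
        by (metis mult.left_commute mult.right_neutral)
      then show ?thesis
        by (simp only: u_def complex_Re_of_nat)
    qed
    have start: "\<bar>r i\<bar> \<le> real k" if "i < k" for i
    proof -
      have "\<bar>u i\<bar> \<le> cmod (cnj (\<xi> ^ N) * (of_nat i * \<xi> ^ i))"
        unfolding u_def by (rule abs_Re_le_cmod)
      also have "\<dots> = real i"
        using unit by (simp add: norm_mult norm_power)
      finally show ?thesis
        using that by (simp add: r_def lmm_map_def)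
    qed
    \<comment> \<open>The factor \<open>real N\<close> is the reciprocal of the step size; the step
      size in \<open>norm_kdollar\<close> will cancel it.\<close>
    have r: "r i = real N * Re (- cnj (\<xi> ^ N) * D * \<xi> ^ (i - k))" if "k \<le> i" for i
    proof -
      \<comment> \<open>The coefficients are real, so taking real parts commutes with the difference
        operator.\<close>
      have "(\<Sum>j=0..k. \<alpha> j * u (i - j)) = Re (cnj (\<xi> ^ N) *
          (\<Sum>j=0..k. of_real (\<alpha> j) * (of_nat (i - j) * \<xi> ^ (i - j))))"
        unfolding sum_distrib_left Re_sum u_def
        by (intro sum.cong refl) (simp add: algebra_simps)
      also have "\<dots> = Re (- cnj (\<xi> ^ N) * D * \<xi> ^ (i - k))"
        unfolding difference_operator_resonance[OF root that] D_def
        by (simp only: mult_minus_left mult_minus_right mult.assoc)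
      finally show ?thesis
        using that by (simp only: r_def lmm_map_def step_size_def) simp
    qed
    have sums: "step_size 1 N * \<bar>\<Sum>i=k..l. r i\<bar> \<le> B" if "k \<le> l" for l
    proof -
      have "(\<Sum>i=k..l. r i) =
          real N * Re (- cnj (\<xi> ^ N) * D * (\<Sum>i=k..l. \<xi> ^ (i - k)))"
        unfolding sum_distrib_left Re_sum by (intro sum.cong refl) (simp add: r)
      then have "step_size 1 N * \<bar>\<Sum>i=k..l. r i\<bar> =
          \<bar>Re (- cnj (\<xi> ^ N) * D * (\<Sum>i=k..l. \<xi> ^ (i - k)))\<bar>"
        using \<open>N > 0\<close> by (simp only: step_size_def abs_mult) simp
      also have "\<dots> \<le> cmod (- cnj (\<xi> ^ N) * D * (\<Sum>i=k..l. \<xi> ^ (i - k)))"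
        by (rule abs_Re_le_cmod)
      also have "\<dots> = cmod D * cmod (\<Sum>i=k..l. \<xi> ^ (i - k))"
        using unit by (simp add: norm_mult norm_power)
      also have "\<dots> \<le> B"
        unfolding B_def
        by (intro mult_left_mono norm_sum_power_unimodular_le unit \<open>\<xi> \<noteq> 1\<close> that) simp
      finally show ?thesis .
    qed
    have "real N \<le> norm_kinf k 1 N u"
      using norm_kinf_ge[OF assms(1) N(2), of u 1] uN by simp
    also have "\<dots> \<le> S * norm_kdollar k 1 N r"
      using S[OF N, of u "\<lambda>_. 0" "\<lambda>_. 0"] by (simp add: r_def[abs_def])
    \<comment> \<open>The sign of \<open>S\<close> is unknown; with \<open>\<bar>S\<bar>\<close> an
      upper bound for the norm can be inserted.\<close>
    also have "\<dots> \<le> \<bar>S\<bar> * norm_kdollar k 1 N r"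
      by (intro mult_right_mono norm_kdollar_nonneg assms(1) N(2)) auto
    also have "\<dots> \<le> \<bar>S\<bar> * (real k + B)"
      by (intro mult_left_mono norm_kdollar_le assms(1) N(2) start sums) auto
    finally show ?thesis .
  qed
  obtain M :: nat where "\<bar>S\<bar> * (real k + B) < real M"
    using reals_Archimedean2 by blast
  \<comment> \<open>This index exceeds both thresholds \<open>N0\<close> and \<open>k\<close> while
    staying at least \<open>M\<close>.\<close>
  moreover have "real (M + N0 + k) \<le> \<bar>S\<bar> * (real k + B)"
    by (rule bound) auto
  ultimately show False
    by simp
qed

end
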